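(* Let $\mathcal{F}=(S,\mathcal{I})$ be the combination of independence systems $(S_j,\mathcal{I}_j)$, $j\in[M]$, where each $(S_j,\mathcal{I}_j)$ is a $k_j$-growth system ($k_j$ a positive integer). Then $\mathcal{F}$ is a $k$-growth system, where $$k=\max_{e\in S}\ \sum_{j:\, e\in S_j}k_j .$$ In particular, for each $X\subseteq S$ and $I\in\mathcal{I}$ there exists a collection of sets $Z_j\subseteq (I\setminus X)\cap S_j$, $j\in[M]$, such that for every basis $P$ of $X$ (in $\mathcal{F}$) we have $P\cup\big((I\setminus X)\setminus\bigcup_{j=1}^M Z_j\big)\in\mathcal{I}$, and for all $j\in[M]$, $$|Z_j|\le\begin{cases} r_j(X\cap S_j)-|X\cap I\cap S_j| & \text{if } k_j=1,\\ k_j\,|(X\setminus I)\cap S_j| & \text{if } k_j>1,\end{cases}$$ where, for $k_j=1$ (in which case $(S_j,\mathcal{I}_j)$ is a matroid), $r_j$ denotes the rank function of $(S_j,\mathcal{I}_j)$. In general, $|Z_j|\le k_j\,|(X\setminus I)\cap S_j|$ for all $j\in[M]$.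
   Context: An independence system $(S,\mathcal{I})$ is a finite set $S$ with a nonempty downward-closed family $\mathcal{I}\subseteq 2^S$ of independent sets. For $X\subseteq S$, a basis of $X$ is an inclusion-wise maximal independent subset of $X$. Combination: the combination of $(S_j,\mathcal{I}_j)$, $j\in[M]$, is $(S,\mathcal{I})$ with $S=\bigcup_j S_j$ and $\mathcal{I}=\{I\subseteq S: I\cap S_j\in\mathcal{I}_j\ \forall j\in[M]\}$. $k$-growth system ($k$ a positive integer): for all $X\subseteq S$ and all $I\in\mathcal{I}$ there is a partition $(Q,Z)$ of $I\setminus X$ with $|Z|\le k|X\setminus I|$ such that $P\cup Q\in\mathcal{I}$ for every basis $P$ of $X$. *)

theory Defs
  imports Main
begin

locale independence_system =
  fixes S :: "'a set" and \<I> :: "'a set set"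
  assumes finite_ground: "finite S"
    and indep_subset_ground: "\<I> \<subseteq> Pow S"
    and indep_nonempty: "\<I> \<noteq> {}"
    and indep_downward_closed: "\<And>I J. I \<in> \<I> \<Longrightarrow> J \<subseteq> I \<Longrightarrow> J \<in> \<I>"

locale matroid = independence_system S \<I>
  for S :: "'a set" and \<I> :: "'a set set" +
  assumes augmentation:
    "\<And>I J. I \<in> \<I> \<Longrightarrow> J \<in> \<I> \<Longrightarrow> card J < card I \<Longrightarrow> \<exists>e\<in>I - J. insert e J \<in> \<I>"

definition is_basis :: "'a set set \<Rightarrow> 'a set \<Rightarrow> 'a set \<Rightarrow> bool" where
  "is_basis \<I> X B \<longleftrightarrow>
     B \<in> \<I> \<and> B \<subseteq> X \<and> (\<forall>B'\<in>\<I>. B' \<subseteq> X \<longrightarrow> B \<subseteq> B' \<longrightarrow> B' = B)"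

definition rank :: "'a set set \<Rightarrow> 'a set \<Rightarrow> nat" where
  "rank \<I> X = Max (card ` {I \<in> \<I>. I \<subseteq> X})"

text \<open>The two parts of the ordered partition \<open>(Q, Z)\<close> may be empty. The sets \<open>Q\<close> and \<open>Z\<close>
  are chosen before the basis \<open>P\<close>.\<close>

locale growth_system = independence_system S \<I>
  for k :: nat and S :: "'a set" and \<I> :: "'a set set" +
  assumes growth_pos: "k > 0"
    and growth: "\<And>X I. X \<subseteq> S \<Longrightarrow> I \<in> \<I> \<Longrightarrow>
      \<exists>Q Z. Q \<union> Z = I - X \<and> Q \<inter> Z = {} \<and> card Z \<le> k * card (X - I) \<and>
            (\<forall>P. is_basis \<I> X P \<longrightarrow> P \<union> Q \<in> \<I>)"

definition combination_ground :: "'j set \<Rightarrow> ('j \<Rightarrow> 'a set) \<Rightarrow> 'a set" where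
  "combination_ground J S = (\<Union>j\<in>J. S j)"

definition combination_indep ::
  "'j set \<Rightarrow> ('j \<Rightarrow> 'a set) \<Rightarrow> ('j \<Rightarrow> 'a set set) \<Rightarrow> 'a set set" where
  "combination_indep J S \<I> =
     {I. I \<subseteq> combination_ground J S \<and> (\<forall>j\<in>J. I \<inter> S j \<in> \<I> j)}"

end

theory Submission
  imports Defs
begin

text \<open>A basis \<open>P\<close> of \<open>X\<close> in the combination traces an independent subset of \<open>X \<inter> S\<^sub>j\<close>, which
  extends to a basis there. Hence sets \<open>Z\<^sub>j\<close> chosen for each component separately can simply be
  removed together, and double counting pairs \<open>(e, j)\<close> with \<open>e \<in> X - I\<close> and \<open>e \<in> S\<^sub>j\<close> bounds the
  size of their union. For \<open>k\<^sub>j = 1\<close> the sharper rank bound comes from applying growth not to \<open>X\<close>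
  but to a basis \<open>B\<close> of \<open>X\<close> containing \<open>X \<inter> I\<close>: the resulting \<open>Z\<close> has at most
  \<open>card (B - I) = card B - card (X \<inter> I)\<close> elements, and by matroid exchange it works for every
  other basis of \<open>X\<close> too.\<close>

section \<open>Bases and rank in independence systems\<close>

context independence_system
begin

lemma finite_indep: "finite \<I>"
  using finite_subset[OF indep_subset_ground] finite_ground by simp

lemma indep_finite: "I \<in> \<I> \<Longrightarrow> finite I"
  using finite_subset[OF _ finite_ground] indep_subset_ground by auto

lemma basis_extension:
  assumes "I \<in> \<I>" "I \<subseteq> X"
  obtains B where "is_basis \<I> X B" "I \<subseteq> B"
proof -
  have "finite {J \<in> \<I>. J \<subseteq> X}" "I \<in> {J \<in> \<I>. J \<subseteq> X}"
    using finite_indep assms by simp_all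
  from finite_has_maximal2[OF this] show thesis
  proof (elim bexE conjE)
    fix B assume "B \<in> {J \<in> \<I>. J \<subseteq> X}" "I \<subseteq> B"
      and "\<forall>J\<in>{J \<in> \<I>. J \<subseteq> X}. B \<subseteq> J \<longrightarrow> B = J"
    then show thesis
      by (intro that[of B]) (auto simp: is_basis_def)
  qed
qed

lemma card_le_rank:
  assumes "I \<in> \<I>" "I \<subseteq> X"
  shows "card I \<le> rank \<I> X"
  unfolding rank_def using assms finite_indep by simp

text \<open>Applied to an independent set in place of \<open>X\<close>, the growth axiom quantifies
  over a single basis, so it yields one plain membership.\<close>

lemma basis_indep: "B \<in> \<I> \<Longrightarrow> is_basis \<I> B P \<longleftrightarrow> P = B"
  unfolding is_basis_def by auto

end

section \<open>Basis exchange in matroids\<close>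

context matroid
begin

lemma card_indep_le_basis:
  assumes B: "is_basis \<I> X B" and I: "I \<in> \<I>" "I \<subseteq> X"
  shows "card I \<le> card B"
proof (rule ccontr)
  assume "\<not> ?thesis"
  then have less: "card B < card I"
    by simp
  have B': "B \<in> \<I>" "B \<subseteq> X" "\<And>B'. B' \<in> \<I> \<Longrightarrow> B' \<subseteq> X \<Longrightarrow> B \<subseteq> B' \<Longrightarrow> B' = B"
    using B unfolding is_basis_def by auto
  obtain e where e: "e \<in> I - B" "insert e B \<in> \<I>"
    using augmentation[OF I(1) B'(1) less] by auto
  have "insert e B = B"
    using B'(3)[OF e(2)] e(1) I(2) B'(2) by auto
  then show False
    using e(1) by auto
qed

text \<open>Enlarge \<open>P\<close> to a basis \<open>T\<close> of
  \<open>P \<union> (B \<union> Q)\<close>. Maximality of \<open>P\<close> in \<open>X\<close> keeps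
  \<open>T\<close> from gaining elements of \<open>X\<close>, so \<open>T\<close> lies in
  \<open>P \<union> Q\<close>; comparing cardinalities with \<open>B \<union> Q\<close> forces
  equality.\<close>

lemma basis_exchange_outside:
  assumes B: "is_basis \<I> X B" and P: "is_basis \<I> X P"
    and Q: "Q \<inter> X = {}" "B \<union> Q \<in> \<I>"
  shows "P \<union> Q \<in> \<I>"
proof -
  have sub: "B \<subseteq> X" "P \<subseteq> X" "P \<in> \<I>" and "B \<in> \<I>"
    using B P unfolding is_basis_def by auto
  have fin: "finite P" "finite B" "finite Q"
    using indep_finite sub(3) Q(2) by auto
  obtain T where T: "is_basis \<I> (P \<union> (B \<union> Q)) T" "P \<subseteq> T"
    using basis_extension[OF sub(3), of "P \<union> (B \<union> Q)"] by auto
  have T_indep: "T \<in> \<I>"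
    using T(1) unfolding is_basis_def by simp
  have "T \<inter> X \<in> \<I>"
    using indep_downward_closed[OF T_indep] by simp
  then have "T \<inter> X = P"
    using P T(2) sub(2) unfolding is_basis_def by simp
  moreover have "T \<subseteq> P \<union> (B \<union> Q)"
    using T(1) unfolding is_basis_def by simp
  ultimately have T_sub: "T \<subseteq> P \<union> Q"
    using sub(1) by blast
  have "card (P \<union> Q) \<le> card P + card Q"
    by (rule card_Un_le)
  also have "\<dots> \<le> card B + card Q"
    using card_indep_le_basis[OF B sub(3,2)] by simp
  also have "\<dots> = card (B \<union> Q)"
    using fin Q(1) sub(1) by (subst card_Un_disjoint) auto
  also have "\<dots> \<le> card T"
    using card_indep_le_basis[OF T(1) Q(2)] by simp
  finally have "T = P \<union> Q"
    using card_seteq[OF _ T_sub] fin by simp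
  then show ?thesis
    using T_indep by simp
qed

end

section \<open>The case of growth constant 1\<close>

text \<open>Growth with \<open>X\<close> taken to be \<open>J\<close> discards at most
  \<open>card (J - I)\<close> elements of \<open>I - J\<close>, which is fewer than all of them. Any
  survivor in \<open>Q\<close> augments \<open>J\<close>.\<close>

lemma growth_system_one_imp_matroid:
  assumes "growth_system 1 S \<I>"
  shows "matroid S \<I>"
proof -
  interpret growth_system 1 S \<I> by fact
  show ?thesis
  proof unfold_locales
    fix I J assume I: "I \<in> \<I>" and J: "J \<in> \<I>" and less: "card J < card I"
    obtain Q Z where QZ: "Q \<union> Z = I - J" "card Z \<le> card (J - I)" and JQ: "J \<union> Q \<in> \<I>"
      using growth[of J I] I J indep_subset_ground basis_indep[OF J] by auto
    have "card (J - I) < card (I - J)"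
      using less card_less_sym_Diff[of J I] indep_finite[OF I] indep_finite[OF J] by blast
    then have "Q \<noteq> {}"
      using QZ by auto
    then obtain e where "e \<in> Q"
      by blast
    moreover have "insert e J \<in> \<I>"
      using indep_downward_closed[OF JQ] \<open>e \<in> Q\<close> by simp
    ultimately show "\<exists>e\<in>I - J. insert e J \<in> \<I>"
      using QZ(1) by blast
  qed
qed

text \<open>The final theorem needs both cardinality bounds for the same \<open>Z\<close>. The rank
  bound is a sum, which avoids truncated subtraction; \<open>X \<inter> S\<close> appears because
  \<open>X\<close> may leave the ground set.\<close>

lemma growth_system_one_rank_bound:
  assumes "growth_system 1 S \<I>" and I: "I \<in> \<I>"
  obtains Z where "Z \<subseteq> I - X" "\<And>P. is_basis \<I> X P \<Longrightarrow> P \<union> (I - X - Z) \<in> \<I>"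
    "card Z + card (X \<inter> I) \<le> rank \<I> X" "card Z \<le> card (X \<inter> S - I)"
proof -
  interpret growth_system 1 S \<I> by fact
  interpret matroid S \<I>
    using assms(1) by (rule growth_system_one_imp_matroid)
  obtain B where B: "is_basis \<I> X B" "X \<inter> I \<subseteq> B"
    using basis_extension[of "X \<inter> I" X] indep_downward_closed[OF I] by blast
  have B': "B \<in> \<I>" "B \<subseteq> X" "B \<subseteq> S" "finite B"
    using B indep_subset_ground indep_finite unfolding is_basis_def by auto
  \<comment> \<open>Since \<open>X \<inter> I \<subseteq> B \<subseteq> X\<close>, a partition
    obtained from growth at \<open>B\<close> is already one of \<open>I - X\<close>.\<close>
  have diff: "I - B = I - X"
    using B(2) B'(2) by blast
  obtain Q Z where QZ: "Q \<union> Z = I - X" "Q \<inter> Z = {}" "card Z \<le> card (B - I)"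
    and BQ: "B \<union> Q \<in> \<I>"
    using growth[OF B'(3) I] basis_indep[OF B'(1)] diff by auto
  have "card (B - I) + card (X \<inter> I) = card B"
  proof -
    have "B = (B - I) \<union> (X \<inter> I)"
      using B(2) B'(2) by blast
    moreover have "finite (X \<inter> I)" "finite (B - I)" "(B - I) \<inter> (X \<inter> I) = {}"
      using B(2) B'(4) finite_subset by auto
    ultimately show ?thesis
      using card_Un_disjoint by metis
  qed
  moreover have "card B \<le> rank \<I> X"
    using B' by (intro card_le_rank)
  ultimately have "card Z + card (X \<inter> I) \<le> rank \<I> X"
    using QZ(3) by simp
  moreover have "card Z \<le> card (X \<inter> S - I)"
  proof -
    have "B - I \<subseteq> X \<inter> S - I"
      using B' by blast
    then show ?thesis
      using QZ(3) card_mono[of "X \<inter> S - I" "B - I"] finite_ground by simp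
  qed
  moreover have "P \<union> (I - X - Z) \<in> \<I>" if "is_basis \<I> X P" for P
  proof -
    have "I - X - Z = Q"
      using QZ by blast
    then show ?thesis
      using basis_exchange_outside[OF B(1) that _ BQ] QZ(1) by blast
  qed
  ultimately show thesis
    using that QZ(1) by blast
qed

section \<open>Combinations of independence systems\<close>

lemma independence_system_combination:
  assumes "finite J" and sys: "\<And>j. j \<in> J \<Longrightarrow> independence_system (S j) (\<I> j)"
  shows "independence_system (combination_ground J S) (combination_indep J S \<I>)"
proof
  show "finite (combination_ground J S)"
    unfolding combination_ground_def
    using assms independence_system.finite_ground by blast
  show "combination_indep J S \<I> \<subseteq> Pow (combination_ground J S)"
    unfolding combination_indep_def by blast
  have "{} \<in> \<I> j" if "j \<in> J" for j
  proof -
    interpret independence_system "S j" "\<I> j"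
      using sys that .
    show ?thesis
      using indep_nonempty indep_downward_closed by auto
  qed
  then have "{} \<in> combination_indep J S \<I>"
    unfolding combination_indep_def by simp
  then show "combination_indep J S \<I> \<noteq> {}"
    by blast
  fix I K assume I: "I \<in> combination_indep J S \<I>" and "K \<subseteq> I"
  have "K \<inter> S j \<in> \<I> j" if "j \<in> J" for j
  proof (rule independence_system.indep_downward_closed[OF sys[OF that]])
    show "I \<inter> S j \<in> \<I> j"
      using I that unfolding combination_indep_def by simp
    show "K \<inter> S j \<subseteq> I \<inter> S j"
      using \<open>K \<subseteq> I\<close> by blast
  qed
  then show "K \<in> combination_indep J S \<I>"
    using I \<open>K \<subseteq> I\<close> unfolding combination_indep_def by auto
qed

lemma combination_indep_Un_Diff:
  assumes sys: "\<And>j. j \<in> J \<Longrightarrow> independence_system (S j) (\<I> j)"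
    and I: "I \<in> combination_indep J S \<I>"
    and P: "P \<in> combination_indep J S \<I>" "P \<subseteq> X"
    and Z: "\<And>j B. j \<in> J \<Longrightarrow> is_basis (\<I> j) (X \<inter> S j) B \<Longrightarrow>
      B \<union> ((I - X) \<inter> S j - Z j) \<in> \<I> j"
  shows "P \<union> (I - X - (\<Union>j\<in>J. Z j)) \<in> combination_indep J S \<I>"
proof -
  have "(P \<union> (I - X - (\<Union>j\<in>J. Z j))) \<inter> S j \<in> \<I> j" if j: "j \<in> J" for j
  proof -
    interpret independence_system "S j" "\<I> j"
      using sys j .
    have "P \<inter> S j \<in> \<I> j"
      using P(1) j unfolding combination_indep_def by blast
    then obtain B where B: "is_basis (\<I> j) (X \<inter> S j) B" "P \<inter> S j \<subseteq> B"
      using basis_extension[of "P \<inter> S j" "X \<inter> S j"] P(2) by blast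
    show ?thesis
      \<comment> \<open>Within \<open>S j\<close>, replacing \<open>B\<close> by
        \<open>P \<inter> S j\<close> and removing the sets of the other components only shrinks the
        independent set supplied by \<open>Z\<close>.\<close>
      by (rule indep_downward_closed[OF Z[OF j B(1)]]) (use B(2) j in blast)
  qed
  then show ?thesis
    using I P(1) unfolding combination_indep_def by blast
qed

text \<open>The application takes \<open>Y\<close> to be \<open>X - I\<close> and \<open>A\<close>
  to be the family of component ground sets.\<close>

lemma card_UN_le_Max_incidence:
  fixes k :: "'j \<Rightarrow> nat"
  assumes fin: "finite J" "finite S" and Y: "Y \<subseteq> S"
    and Z: "\<And>j. j \<in> J \<Longrightarrow> card (Z j) \<le> k j * card (Y \<inter> A j)"
  shows "card (\<Union>j\<in>J. Z j) \<le> (MAX e\<in>S. \<Sum>j | j \<in> J \<and> e \<in> A j. k j) * card Y"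
proof -
  let ?d = "\<lambda>e. \<Sum>j | j \<in> J \<and> e \<in> A j. k j"
  have finY: "finite Y"
    using Y fin(2) finite_subset by blast
  have "card (\<Union>j\<in>J. Z j) \<le> (\<Sum>j\<in>J. card (Z j))"
    using fin(1) by (rule card_UN_le)
  also have "\<dots> \<le> (\<Sum>j\<in>J. k j * card (Y \<inter> A j))"
    using Z by (rule sum_mono)
  also have "\<dots> = (\<Sum>j\<in>J. \<Sum>e | e \<in> Y \<and> e \<in> A j. k j)"
    by (simp add: Int_def mult.commute)
  also have "\<dots> = (\<Sum>e\<in>Y. ?d e)"
    using fin(1) finY by (rule sum.swap_restrict)
  \<comment> \<open>Each \<open>e\<close> in \<open>Y\<close> lies in \<open>S\<close>, so its own
    weight \<open>?d e\<close> competes in the maximum.\<close>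
  also have "\<dots> \<le> (\<Sum>e\<in>Y. MAX e\<in>S. ?d e)"
    using Y fin(2) by (intro sum_mono Max_ge) auto
  finally show ?thesis
    by (simp add: mult.commute)
qed

text \<open>The growth claim is guarded by \<open>S \<noteq> {}\<close> because a maximum over the
  empty set is unspecified. The rank difference is taken in the integers, where it cannot be
  truncated at 0.\<close>

theorem lemma4:
  fixes M :: nat
    and Sj :: "nat \<Rightarrow> 'a set" and \<I>j :: "nat \<Rightarrow> 'a set set" and k :: "nat \<Rightarrow> nat"
    and S :: "'a set" and \<I> :: "'a set set"
  assumes growth: "\<And>j. j \<in> {1..M} \<Longrightarrow> growth_system (k j) (Sj j) (\<I>j j)"
    and S: "S = combination_ground {1..M} Sj"
    and \<I>: "\<I> = combination_indep {1..M} Sj \<I>j"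
  shows "(S \<noteq> {} \<longrightarrow>
           growth_system (MAX e\<in>S. \<Sum>j | j \<in> {1..M} \<and> e \<in> Sj j. k j) S \<I>) \<and>
         (\<forall>j\<in>{1..M}. k j = 1 \<longrightarrow> matroid (Sj j) (\<I>j j)) \<and>
         (\<forall>X I. X \<subseteq> S \<longrightarrow> I \<in> \<I> \<longrightarrow>
           (\<exists>Z :: nat \<Rightarrow> 'a set.
              (\<forall>j\<in>{1..M}. Z j \<subseteq> (I - X) \<inter> Sj j) \<and>
              (\<forall>P. is_basis \<I> X P \<longrightarrow> P \<union> ((I - X) - (\<Union>j\<in>{1..M}. Z j)) \<in> \<I>) \<and>
              (\<forall>j\<in>{1..M}. int (card (Z j)) \<le>
                 (if k j = 1
                  then int (rank (\<I>j j) (X \<inter> Sj j)) - int (card (X \<inter> I \<inter> Sj j))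
                  else int (k j * card ((X - I) \<inter> Sj j)))) \<and>
              (\<forall>j\<in>{1..M}. card (Z j) \<le> k j * card ((X - I) \<inter> Sj j))))"
proof -
  have sys: "independence_system (Sj j) (\<I>j j)" if "j \<in> {1..M}" for j
    using growth[OF that] by (rule growth_system.axioms)
  interpret independence_system S \<I>
    unfolding S \<I> using sys by (intro independence_system_combination) auto
  define good where "good X I j Z \<longleftrightarrow> Z \<subseteq> (I - X) \<inter> Sj j \<and>
      (\<forall>P. is_basis (\<I>j j) (X \<inter> Sj j) P \<longrightarrow> P \<union> ((I - X) \<inter> Sj j - Z) \<in> \<I>j j) \<and>
      (k j = 1 \<longrightarrow> card Z + card (X \<inter> I \<inter> Sj j) \<le> rank (\<I>j j) (X \<inter> Sj j)) \<and>
      card Z \<le> k j * card ((X - I) \<inter> Sj j)" for X I j Z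
  have ex_good: "\<exists>Z. good X I j Z" if I: "I \<in> \<I>" and j: "j \<in> {1..M}" for X I j
  proof -
    have Ij: "I \<inter> Sj j \<in> \<I>j j"
      using I j unfolding \<I> combination_indep_def by blast
    have eq: "I \<inter> Sj j - X \<inter> Sj j = (I - X) \<inter> Sj j" "X \<inter> Sj j - I \<inter> Sj j = (X - I) \<inter> Sj j"
      "X \<inter> Sj j \<inter> Sj j - I \<inter> Sj j = (X - I) \<inter> Sj j"
      "X \<inter> Sj j \<inter> (I \<inter> Sj j) = X \<inter> I \<inter> Sj j"
      by auto
    show ?thesis
    proof (cases "k j = 1")
      case True
      have growth1: "growth_system 1 (Sj j) (\<I>j j)"
        using growth[OF j] True by simp
      show ?thesis
      proof (rule growth_system_one_rank_bound[OF growth1 Ij, of "X \<inter> Sj j", unfolded eq])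
        fix Z assume "Z \<subseteq> (I - X) \<inter> Sj j"
          and "\<And>P. is_basis (\<I>j j) (X \<inter> Sj j) P \<Longrightarrow> P \<union> ((I - X) \<inter> Sj j - Z) \<in> \<I>j j"
          and "card Z + card (X \<inter> I \<inter> Sj j) \<le> rank (\<I>j j) (X \<inter> Sj j)"
          and "card Z \<le> card ((X - I) \<inter> Sj j)"
        then show ?thesis
          using True unfolding good_def by (intro exI[of _ Z]) simp
      qed
    next
      case False
      \<comment> \<open>Here the component need not be a matroid, so growth is applied to
        \<open>X \<inter> Sj j\<close> itself rather than to one of its bases.\<close>
      obtain Q Z where QZ: "Q \<union> Z = (I - X) \<inter> Sj j" "Q \<inter> Z = {}"
        "card Z \<le> k j * card ((X - I) \<inter> Sj j)"
        and Q: "\<And>P. is_basis (\<I>j j) (X \<inter> Sj j) P \<Longrightarrow> P \<union> Q \<in> \<I>j j"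
        using growth_system.growth[OF growth[OF j] _ Ij, of "X \<inter> Sj j"] by (auto simp: eq)
      moreover have "(I - X) \<inter> Sj j - Z = Q"
        using QZ by blast
      ultimately show ?thesis
        using False unfolding good_def by (intro exI[of _ Z]) auto
    qed
  qed
  \<comment> \<open>The choice depends on \<open>X\<close>, \<open>I\<close> and \<open>j\<close>
    but not on a basis \<open>P\<close>, as the order of quantifiers in the growth axiom
    demands.\<close>
  define Z where "Z X I j = (SOME Z. good X I j Z)" for X I j
  have good: "good X I j (Z X I j)" if "I \<in> \<I>" "j \<in> {1..M}" for X I j
    unfolding Z_def using ex_good[OF that] by (rule someI_ex)
  have Z_sub: "Z X I j \<subseteq> (I - X) \<inter> Sj j"
    and Z_rank: "k j = 1 \<Longrightarrow>
      card (Z X I j) + card (X \<inter> I \<inter> Sj j) \<le> rank (\<I>j j) (X \<inter> Sj j)"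
    and Z_card: "card (Z X I j) \<le> k j * card ((X - I) \<inter> Sj j)"
    if "I \<in> \<I>" "j \<in> {1..M}" for X I j
    using good[OF that, of X] unfolding good_def by simp_all
  have Z_indep: "P \<union> (I - X - (\<Union>j\<in>{1..M}. Z X I j)) \<in> \<I>"
    if "I \<in> \<I>" "is_basis \<I> X P" for X I P
    unfolding \<I>
  proof (rule combination_indep_Un_Diff[OF sys])
    show "I \<in> combination_indep {1..M} Sj \<I>j" "P \<in> combination_indep {1..M} Sj \<I>j" "P \<subseteq> X"
      using that unfolding \<I> is_basis_def by simp_all
    show "B \<union> ((I - X) \<inter> Sj j - Z X I j) \<in> \<I>j j"
      if "j \<in> {1..M}" "is_basis (\<I>j j) (X \<inter> Sj j) B" for j B
      using good[OF \<open>I \<in> \<I>\<close> that(1), of X] that(2) unfolding good_def by simp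
  qed
  have "growth_system (MAX e\<in>S. \<Sum>j | j \<in> {1..M} \<and> e \<in> Sj j. k j) S \<I>"
    (is "growth_system ?k S \<I>") if "S \<noteq> {}"
  proof
    \<comment> \<open>Positivity: any element of \<open>S\<close> lies in some component, whose
      positive constant is a summand of its weight.\<close>
    obtain e j where e: "e \<in> S" "j \<in> {1..M}" "e \<in> Sj j"
      using \<open>S \<noteq> {}\<close> unfolding S combination_ground_def by blast
    have "0 < k j"
      using growth_system.growth_pos[OF growth[OF e(2)]] .
    also have "k j \<le> (\<Sum>j | j \<in> {1..M} \<and> e \<in> Sj j. k j)"
      using e by (intro member_le_sum) auto
    also have "\<dots> \<le> ?k"
      using e finite_ground by (intro Max_ge) auto
    finally show "0 < ?k" .
  next
    fix X I assume X: "X \<subseteq> S" and I: "I \<in> \<I>"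
    let ?Z = "\<Union>j\<in>{1..M}. Z X I j"
    have "card ?Z \<le> ?k * card (X - I)"
      using X finite_ground Z_card[OF I] by (intro card_UN_le_Max_incidence) auto
    moreover have "?Z \<subseteq> I - X"
      using Z_sub[OF I] by blast
    then have "(I - X - ?Z) \<union> ?Z = I - X" "(I - X - ?Z) \<inter> ?Z = {}"
      by auto
    ultimately show "\<exists>Q Z. Q \<union> Z = I - X \<and> Q \<inter> Z = {} \<and> card Z \<le> ?k * card (X - I) \<and>
        (\<forall>P. is_basis \<I> X P \<longrightarrow> P \<union> Q \<in> \<I>)"
      using Z_indep[OF I] by (intro exI[of _ "I - X - ?Z"] exI[of _ ?Z] conjI) simp_all
  qed
  moreover have "matroid (Sj j) (\<I>j j)" if "j \<in> {1..M}" "k j = 1" for j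
    using growth[OF that(1)] that(2) growth_system_one_imp_matroid by simp
  moreover have "\<exists>Z. (\<forall>j\<in>{1..M}. Z j \<subseteq> (I - X) \<inter> Sj j) \<and>
      (\<forall>P. is_basis \<I> X P \<longrightarrow> P \<union> ((I - X) - (\<Union>j\<in>{1..M}. Z j)) \<in> \<I>) \<and>
      (\<forall>j\<in>{1..M}. int (card (Z j)) \<le>
         (if k j = 1
          then int (rank (\<I>j j) (X \<inter> Sj j)) - int (card (X \<inter> I \<inter> Sj j))
          else int (k j * card ((X - I) \<inter> Sj j)))) \<and>
      (\<forall>j\<in>{1..M}. card (Z j) \<le> k j * card ((X - I) \<inter> Sj j))"
    if I: "I \<in> \<I>" for X I
  proof (intro exI[of _ "Z X I"] conjI ballI allI impI)
    fix j assume j: "j \<in> {1..M}"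
    show "Z X I j \<subseteq> (I - X) \<inter> Sj j"
      using Z_sub[OF I j] .
    show "card (Z X I j) \<le> k j * card ((X - I) \<inter> Sj j)"
      using Z_card[OF I j] .
    then show "int (card (Z X I j)) \<le>
         (if k j = 1
          then int (rank (\<I>j j) (X \<inter> Sj j)) - int (card (X \<inter> I \<inter> Sj j))
          else int (k j * card ((X - I) \<inter> Sj j)))"
      using Z_rank[OF I j, of X]
      \<comment> \<open>Moving the subtracted cardinality to the left turns the integer inequality
        into the additive bound \<open>Z_rank\<close>.\<close>
      by (simp only: of_nat_le_iff le_diff_eq flip: of_nat_add split: if_split) simp
  next
    fix P assume "is_basis \<I> X P"
    then show "P \<union> ((I - X) - (\<Union>j\<in>{1..M}. Z X I j)) \<in> \<I>"
      using Z_indep[OF I] by simp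
  qed
  ultimately show ?thesis
    by simp
qed

end
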